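(* Let $X$ be a Gaussian random variable with mean $\theta\in\mathbb{R}$ and variance $\sigma^2>0$. Its $n$th moments $M(X^n)$ are given by the formula $$M(X^n)=\frac{\theta^n}{\sqrt{\pi}}\sum_{\substack{l\ge0\\ 2l\le n}}\Gamma\left(l+\tfrac12\right)C_{2l}^n\left(\frac{2\sigma^2}{\theta^2}\right)^{l},$$ where $l$ runs over nonnegative integers and $C_{2l}^n=\frac{n!}{(n-2l)!\,(2l)!}$.
   Context: $M(X^n)$ denotes the $n$th moment $E[X^n]=\int_{-\infty}^{+\infty}x^n f_X(x)\,dx$, where $f_X$ is the density of $X$.
   Formalization: For mean θ = 0 the displayed formula divides by zero; it is stated as printed for θ ≠ 0, and for every real θ (including 0) in the form with θ^n multiplied into the sum, i.e. with (2σ²)^l θ^(n−2l), where 0^0 = 1. *)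

theory Defs
  imports "HOL-Probability.Probability"
begin

end

theory Submission
  imports Defs
begin

text \<open>Expand \<open>X ^ n = ((X - \<theta>) + \<theta>) ^ n\<close> binomially: the odd central moments of a normal
  variable vanish, and the even ones are
  \<open>(2 * l)! / (4 ^ l * l!) * (2 * \<sigma>\<^sup>2) ^ l = Gamma (l + 1/2) / sqrt pi * (2 * \<sigma>\<^sup>2) ^ l\<close>.\<close>

text \<open>The functional equation of \<open>Gamma\<close> starting from
  \<open>Gamma (1 / 2) = sqrt pi\<close>: each step contributes the factor
  \<open>l + 1/2 = (2*l + 1) * (2*l + 2) / (4 * (l + 1))\<close>.\<close>

lemma Gamma_nat_plus_half:
  "Gamma (real l + 1 / 2) = sqrt pi * fact (2 * l) / (4 ^ l * fact l)"
proof (induction l)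
  case 0
  then show ?case by (simp add: Gamma_one_half_real)
next
  case (Suc l)
  have "real l + 1 / 2 \<notin> \<int>\<^sub>\<le>\<^sub>0"
    by (auto elim!: nonpos_Ints_cases)
  then have "Gamma (real (Suc l) + 1 / 2) = (real l + 1 / 2) * Gamma (real l + 1 / 2)"
    using Gamma_plus1[of "real l + 1 / 2"] by (simp add: add_ac)
  also have "\<dots> = sqrt pi * fact (2 * Suc l) / (4 ^ Suc l * fact (Suc l))"
  proof -
    have "1 + real l \<noteq> 0"
      by linarith
    then show ?thesis
      unfolding Suc.IH by (simp add: divide_simps) (simp add: algebra_simps)
  qed
  finally show ?case .
qed

lemma normal_moment_even_Gamma:
  assumes "0 < \<sigma>"
  shows "has_bochner_integral lborel (\<lambda>x. normal_density \<mu> \<sigma> x * (x - \<mu>) ^ (2 * l))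
    (Gamma (real l + 1 / 2) / sqrt pi * (2 * \<sigma>\<^sup>2) ^ l)"
proof -
  \<comment> \<open>One factor \<open>2 ^ l\<close> cancels against
    \<open>(2 * \<sigma>\<^sup>2) ^ l\<close>; the other is the \<open>2 ^ l\<close> in the
    denominator of \<open>normal_moment_even\<close>.\<close>
  have "(4::real) ^ l = 2 ^ l * 2 ^ l"
    by (simp flip: power_mult_distrib)
  then have "fact (2 * l) / ((2 / \<sigma>\<^sup>2) ^ l * fact l) =
      Gamma (real l + 1 / 2) / sqrt pi * (2 * \<sigma>\<^sup>2) ^ l"
    unfolding Gamma_nat_plus_half using assms by (simp add: field_simps)
  then show ?thesis
    using normal_moment_even[OF assms, of \<mu> l] by simp
qed

text \<open>Keeping \<open>\<mu> ^ (n - 2 * l)\<close> inside the sum avoids dividing by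
  \<open>\<mu>\<close>, so the case \<open>\<mu> = 0\<close> is covered: since
  \<open>0 ^ 0 = 1\<close>, only a term with \<open>2 * l = n\<close> survives there.\<close>

lemma has_bochner_integral_normal_power:
  assumes "0 < \<sigma>"
  shows "has_bochner_integral lborel (\<lambda>x. normal_density \<mu> \<sigma> x * x ^ n)
    (1 / sqrt pi *
      (\<Sum>l \<in> {l. 2 * l \<le> n}.
        Gamma (real l + 1 / 2) * (fact n / (fact (n - 2 * l) * fact (2 * l)))
          * ((2 * \<sigma>\<^sup>2) ^ l * \<mu> ^ (n - 2 * l))))"
proof -
  \<comment> \<open>\<open>c j\<close> is the \<open>j\<close>-th central moment, given for both
    parities at once so that the whole binomial sum can be integrated termwise.\<close>
  define c where "c j = (if even j
      then Gamma (real (j div 2) + 1 / 2) / sqrt pi * (2 * \<sigma>\<^sup>2) ^ (j div 2) else 0)" for j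
  have c: "has_bochner_integral lborel (\<lambda>x. normal_density \<mu> \<sigma> x * (x - \<mu>) ^ j) (c j)" for j
  proof (cases "even j")
    case True
    then obtain l where "j = 2 * l" ..
    then show ?thesis
      using normal_moment_even_Gamma[OF assms, of \<mu> l] by (simp add: c_def)
  next
    case False
    then obtain l where "j = 2 * l + 1" ..
    then show ?thesis
      using normal_moment_odd[OF assms, of \<mu> l] by (simp add: c_def)
  qed
  have "has_bochner_integral lborel
      (\<lambda>x. \<Sum>j\<le>n. real (n choose j) * \<mu> ^ (n - j) * (normal_density \<mu> \<sigma> x * (x - \<mu>) ^ j))
      (\<Sum>j\<le>n. real (n choose j) * \<mu> ^ (n - j) * c j)"
    by (intro has_bochner_integral_sum has_bochner_integral_mult_right c)
  moreover have "(\<Sum>j\<le>n. real (n choose j) * \<mu> ^ (n - j) * (normal_density \<mu> \<sigma> x * (x - \<mu>) ^ j))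
      = normal_density \<mu> \<sigma> x * x ^ n" for x
    using binomial_ring[of "x - \<mu>" \<mu> n] by (simp add: sum_distrib_left mult_ac)
  \<comment> \<open>The odd indices drop out because \<open>c\<close> vanishes there; the remaining
    ones are exactly the doubles \<open>2 * l\<close>, which allows reindexing by
    \<open>l\<close>.\<close>
  moreover have "(\<Sum>j\<le>n. real (n choose j) * \<mu> ^ (n - j) * c j) =
      (\<Sum>j\<in>(*) 2 ` {l. 2 * l \<le> n}. real (n choose j) * \<mu> ^ (n - j) * c j)"
    by (rule sum.mono_neutral_right) (auto simp: c_def elim!: evenE)
  moreover have "\<dots> = (\<Sum>l | 2 * l \<le> n. real (n choose (2 * l)) * \<mu> ^ (n - 2 * l) * c (2 * l))"
    by (subst sum.reindex) (auto simp: inj_on_def)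
  moreover have "\<dots> = 1 / sqrt pi *
      (\<Sum>l \<in> {l. 2 * l \<le> n}.
        Gamma (real l + 1 / 2) * (fact n / (fact (n - 2 * l) * fact (2 * l)))
          * ((2 * \<sigma>\<^sup>2) ^ l * \<mu> ^ (n - 2 * l)))"
    by (auto simp: sum_distrib_left c_def binomial_fact mult_ac intro!: sum.cong)
  ultimately show ?thesis
    by simp
qed

text \<open>The quotient form is restricted to \<open>\<theta> \<noteq> 0\<close>: at
  \<open>\<theta> = 0\<close> its right-hand side is 0 for every \<open>n > 0\<close>, whereas even
  moments are positive. The last conjunct is the division-free form, valid for all
  \<open>\<theta>\<close>.\<close>

theorem corollary3:
  fixes M :: "'a measure" and X :: "'a \<Rightarrow> real" and \<theta> \<sigma> :: real and n :: nat
  assumes "prob_space M"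
    and "\<sigma> > 0"
    and "distributed M lborel X (normal_density \<theta> \<sigma>)"
  shows "integrable M (\<lambda>\<omega>. X \<omega> ^ n) \<and>
    prob_space.expectation M (\<lambda>\<omega>. X \<omega> ^ n) = (LBINT x. x ^ n * normal_density \<theta> \<sigma> x) \<and>
    (\<theta> \<noteq> 0 \<longrightarrow>
      prob_space.expectation M (\<lambda>\<omega>. X \<omega> ^ n) =
        \<theta> ^ n / sqrt pi *
          (\<Sum>l \<in> {l::nat. 2 * l \<le> n}.
            Gamma (real l + 1 / 2) * (fact n / (fact (n - 2 * l) * fact (2 * l)))
              * (2 * \<sigma>\<^sup>2 / \<theta>\<^sup>2) ^ l)) \<and>
    prob_space.expectation M (\<lambda>\<omega>. X \<omega> ^ n) =
      1 / sqrt pi *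
        (\<Sum>l \<in> {l::nat. 2 * l \<le> n}.
          Gamma (real l + 1 / 2) * (fact n / (fact (n - 2 * l) * fact (2 * l)))
            * ((2 * \<sigma>\<^sup>2) ^ l * \<theta> ^ (n - 2 * l)))"
proof -
  interpret prob_space M by fact
  let ?S = "\<Sum>l \<in> {l::nat. 2 * l \<le> n}.
      Gamma (real l + 1 / 2) * (fact n / (fact (n - 2 * l) * fact (2 * l)))
        * ((2 * \<sigma>\<^sup>2) ^ l * \<theta> ^ (n - 2 * l))"
  note hbi = has_bochner_integral_normal_power[OF assms(2), of \<theta> n]
  have int: "integrable M (\<lambda>\<omega>. X \<omega> ^ n)"
    using distributed_integrable[OF assms(3), of "\<lambda>x. x ^ n"] hbi
    by (simp add: has_bochner_integral_iff)
  have E: "expectation (\<lambda>\<omega>. X \<omega> ^ n) = (\<integral>x. normal_density \<theta> \<sigma> x * x ^ n \<partial>lborel)"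
    using distributed_integral[OF assms(3), of "\<lambda>x. x ^ n"] by simp
  then have LBINT: "expectation (\<lambda>\<omega>. X \<omega> ^ n) = (LBINT x. x ^ n * normal_density \<theta> \<sigma> x)"
    by (simp add: mult.commute)
  have sum: "expectation (\<lambda>\<omega>. X \<omega> ^ n) = 1 / sqrt pi * ?S"
    using E hbi by (simp add: has_bochner_integral_iff)
  have "?S = \<theta> ^ n * (\<Sum>l \<in> {l::nat. 2 * l \<le> n}.
      Gamma (real l + 1 / 2) * (fact n / (fact (n - 2 * l) * fact (2 * l)))
        * (2 * \<sigma>\<^sup>2 / \<theta>\<^sup>2) ^ l)" if "\<theta> \<noteq> 0"
  proof -
    \<comment> \<open>The bound \<open>2 * l \<le> n\<close> keeps the natural subtraction from
      truncating, so the power splits as \<open>\<theta> ^ n / \<theta> ^ (2 * l)\<close>.\<close>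
    have "(2 * \<sigma>\<^sup>2) ^ l * \<theta> ^ (n - 2 * l) = \<theta> ^ n * (2 * \<sigma>\<^sup>2 / \<theta>\<^sup>2) ^ l" if "2 * l \<le> n" for l
      using \<open>\<theta> \<noteq> 0\<close> that by (simp add: power_diff power_divide flip: power_mult)
    then show ?thesis
      by (auto simp: sum_distrib_left intro!: sum.cong)
  qed
  then have "\<theta> \<noteq> 0 \<longrightarrow> expectation (\<lambda>\<omega>. X \<omega> ^ n) = \<theta> ^ n / sqrt pi *
      (\<Sum>l \<in> {l::nat. 2 * l \<le> n}.
        Gamma (real l + 1 / 2) * (fact n / (fact (n - 2 * l) * fact (2 * l)))
          * (2 * \<sigma>\<^sup>2 / \<theta>\<^sup>2) ^ l)"
    unfolding sum by (simp only: times_divide_eq_left mult_1_left) simp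
  with int LBINT sum show ?thesis
    by blast
qed

end
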